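(* Let $\mathbb{F}$ be a field of characteristic different from two and let $A$ be a finite-dimensional commutative $\mathbb{F}$-algebra with squaring map $H_A\colon A\to A$, $H_A(x)=x^2$. Then $\operatorname{edim}(A)=\operatorname{sr}(H_A)$. In particular, $A$ is an evolution algebra if and only if $\operatorname{sr}(H_A)=\dim A$.
   Context: An algebra over a field $\mathbb{F}$ is an $\mathbb{F}$-vector space with a bilinear multiplication, not assumed associative or unital. Algebra morphisms are linear multiplicative maps (not required to preserve a unit). An algebra $E$ over $\mathbb{F}$ is an evolution algebra if it admits a basis $\{e_i : i\in I\}$, called a natural basis, such that $e_ie_j=0$ whenever $i\neq j$. The minimal evolution dimension is $\operatorname{edim}(A)=\min\{\dim E : E \text{ is an evolution } \mathbb{F}\text{-algebra admitting an algebra monomorphism } A\hookrightarrow E\}$. A (simultaneous) Waring decomposition of length $m$ of a homogeneous quadratic map $H\colon V\to V$ on a finite-dimensional vector space $V$ is an expression $H(x)=\sum_{k=1}^m\ell_k(x)^2v_k$ with $\ell_k\in V^*$ and $v_k\in V$; its associated linear map is $L\colon V\to\mathbb{F}^m$, $L(x)=(\ell_1(x),\dots,\ell_m(x))$. The injective simultaneous Waring rank $\operatorname{sr}(H)$ is the minimal length $m$ of a Waring decomposition of $H$ for which $L$ is injective. *)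

theory Defs
  imports Complex_Main "HOL-Library.Extended_Nat" "HOL-Library.Function_Algebras"
    "HOL-Computational_Algebra.Computational_Algebra"
begin

text \<open>
  Algebras are carried by a subspace \<open>E\<close> of an ambient vector space. The product is
  neither associative nor unital, and only its values on \<open>E\<close> matter.
\<close>

locale nonassoc_algebra = vector_space scale
  for scale :: "'f::field \<Rightarrow> 'b::ab_group_add \<Rightarrow> 'b" +
  fixes E :: "'b set" and mul :: "'b \<Rightarrow> 'b \<Rightarrow> 'b"
  assumes subspace_carrier: "subspace E"
    and mul_closed: "\<lbrakk>x \<in> E; y \<in> E\<rbrakk> \<Longrightarrow> mul x y \<in> E"
    and mul_add_left: "\<lbrakk>x \<in> E; y \<in> E; z \<in> E\<rbrakk> \<Longrightarrow> mul (x + y) z = mul x z + mul y z"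
    and mul_add_right: "\<lbrakk>x \<in> E; y \<in> E; z \<in> E\<rbrakk> \<Longrightarrow> mul x (y + z) = mul x y + mul x z"
    and mul_scale_left: "\<lbrakk>x \<in> E; y \<in> E\<rbrakk> \<Longrightarrow> mul (scale c x) y = scale c (mul x y)"
    and mul_scale_right: "\<lbrakk>x \<in> E; y \<in> E\<rbrakk> \<Longrightarrow> mul x (scale c y) = scale c (mul x y)"

definition natural_basis ::
    "('f::field \<Rightarrow> 'b::ab_group_add \<Rightarrow> 'b) \<Rightarrow> 'b set \<Rightarrow> ('b \<Rightarrow> 'b \<Rightarrow> 'b) \<Rightarrow> 'b set \<Rightarrow> bool" where
  "natural_basis scale E mul B \<longleftrightarrow>
     \<not> module.dependent scale B \<and> module.span scale B = E \<and>
     (\<forall>x\<in>B. \<forall>y\<in>B. x \<noteq> y \<longrightarrow> mul x y = 0)"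

definition evolution_algebra ::
    "('f::field \<Rightarrow> 'b::ab_group_add \<Rightarrow> 'b) \<Rightarrow> 'b set \<Rightarrow> ('b \<Rightarrow> 'b \<Rightarrow> 'b) \<Rightarrow> bool" where
  "evolution_algebra scale E mul \<longleftrightarrow>
     nonassoc_algebra scale E mul \<and> (\<exists>B. natural_basis scale E mul B)"

text \<open>Monomorphisms whose source algebra is carried by a whole type.\<close>

definition algebra_mono ::
    "('f::field \<Rightarrow> 'a::ab_group_add \<Rightarrow> 'a) \<Rightarrow> ('a \<Rightarrow> 'a \<Rightarrow> 'a) \<Rightarrow>
     ('f \<Rightarrow> 'b::ab_group_add \<Rightarrow> 'b) \<Rightarrow> 'b set \<Rightarrow> ('b \<Rightarrow> 'b \<Rightarrow> 'b) \<Rightarrow> ('a \<Rightarrow> 'b) \<Rightarrow> bool" where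
  "algebra_mono scaleA mulA scaleE E mulE \<phi> \<longleftrightarrow>
     Vector_Spaces.linear scaleA scaleE \<phi> \<and> range \<phi> \<subseteq> E \<and>
     (\<forall>x y. \<phi> (mulA x y) = mulE (\<phi> x) (\<phi> y)) \<and> inj \<phi>"

text \<open>The library's \<open>dim\<close> is \<open>0\<close> on infinite-dimensional spaces, hence the case distinction.\<close>

definition edimension :: "('f::field \<Rightarrow> 'b::ab_group_add \<Rightarrow> 'b) \<Rightarrow> 'b set \<Rightarrow> enat" where
  "edimension scale E =
     (if \<exists>B. finite B \<and> E \<subseteq> module.span scale B then enat (vector_space.dim scale E) else \<infinity>)"

definition fun_scale :: "'f::field \<Rightarrow> (nat \<Rightarrow> 'f) \<Rightarrow> nat \<Rightarrow> 'f" where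
  "fun_scale c f = (\<lambda>i. c * f i)"

text \<open>
  The target algebras range over all subspaces of the sequence space \<open>nat \<Rightarrow> 'f\<close>, which contains
  a copy of every finite-dimensional space; \<open>edim_le\<close> below shows that algebras carried by
  other types give no smaller value. Minima are taken in \<^typ>\<open>enat\<close>, with \<open>\<infinity>\<close> for the empty set.
\<close>

definition edim :: "('f::field \<Rightarrow> 'a::ab_group_add \<Rightarrow> 'a) \<Rightarrow> ('a \<Rightarrow> 'a \<Rightarrow> 'a) \<Rightarrow> enat" where
  "edim scale mul =
     Inf {edimension fun_scale E | E mulE.
            evolution_algebra fun_scale E mulE \<and>
            (\<exists>\<phi>. algebra_mono scale mul fun_scale E mulE \<phi>)}"

definition waring_decomposition ::
    "('f::field \<Rightarrow> 'a::ab_group_add \<Rightarrow> 'a) \<Rightarrow> ('a \<Rightarrow> 'a) \<Rightarrow>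
     nat \<Rightarrow> (nat \<Rightarrow> 'a \<Rightarrow> 'f) \<Rightarrow> (nat \<Rightarrow> 'a) \<Rightarrow> bool" where
  "waring_decomposition scale H m l v \<longleftrightarrow>
     (\<forall>k<m. Vector_Spaces.linear scale (*) (l k)) \<and>
     (\<forall>x. H x = (\<Sum>k<m. scale ((l k x)\<^sup>2) (v k)))"

text \<open>The space \<open>F\<^sup>m\<close> is embedded in \<open>nat \<Rightarrow> 'f\<close> by padding with zeros.\<close>

definition waring_map :: "nat \<Rightarrow> (nat \<Rightarrow> 'a \<Rightarrow> 'f::zero) \<Rightarrow> 'a \<Rightarrow> nat \<Rightarrow> 'f" where
  "waring_map m l x = (\<lambda>k. if k < m then l k x else 0)"

definition sr :: "('f::field \<Rightarrow> 'a::ab_group_add \<Rightarrow> 'a) \<Rightarrow> ('a \<Rightarrow> 'a) \<Rightarrow> enat" where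
  "sr scale H =
     Inf {enat m | m. \<exists>l v. waring_decomposition scale H m l v \<and> inj (waring_map m l)}"

lemma vector_space_fun_scale: "vector_space fun_scale"
  by standard (auto simp: fun_scale_def fun_eq_iff algebra_simps)

lemma edim_le:
  fixes scaleA :: "'f::field \<Rightarrow> 'a::ab_group_add \<Rightarrow> 'a"
    and scaleE :: "'f \<Rightarrow> 'e::ab_group_add \<Rightarrow> 'e"
  assumes "evolution_algebra scaleE E mulE" and "algebra_mono scaleA mulA scaleE E mulE \<phi>"
  shows "edim scaleA mulA \<le> edimension scaleE E"
proof (cases "\<exists>B. finite B \<and> E \<subseteq> module.span scaleE B")
  case False
  then show ?thesis unfolding edimension_def by (simp only: if_False) simp
next
  case True
  from assms(1) interpret E: nonassoc_algebra scaleE E mulE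
    by (simp add: evolution_algebra_def)
  interpret S: vector_space "fun_scale :: 'f \<Rightarrow> (nat \<Rightarrow> 'f) \<Rightarrow> _"
    by (rule vector_space_fun_scale)
  interpret P: vector_space_pair scaleE "fun_scale :: 'f \<Rightarrow> (nat \<Rightarrow> 'f) \<Rightarrow> _" ..
  from assms(1) obtain B where B: "E.independent B" "E.span B = E"
    and orth: "\<And>x y. \<lbrakk>x \<in> B; y \<in> B; x \<noteq> y\<rbrakk> \<Longrightarrow> mulE x y = 0"
    by (auto simp: evolution_algebra_def natural_basis_def)
  have finB: "finite B"
  proof -
    from True obtain C where C: "finite C" "E \<subseteq> E.span C" by blast
    then show ?thesis
      using E.independent_span_bound[OF C(1) B(1)] B(2) E.span_superset[of B] by simp
  qed
  obtain g :: "'e \<Rightarrow> nat" where g: "inj_on g B"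
    using finite_imp_inj_to_nat_seg[OF finB] by auto
  define \<delta> :: "nat \<Rightarrow> nat \<Rightarrow> 'f" where "\<delta> i = (\<lambda>j. if j = i then 1 else 0)" for i
  have \<delta>_sum: "(\<Sum>i\<in>I. fun_scale (u i) (\<delta> i)) j = (if j \<in> I then u j else 0)"
    if "finite I" for I u j
    using that by (induction I rule: finite_induct) (auto simp: fun_scale_def \<delta>_def)
  have ind_\<delta>: "S.independent (\<delta> ` I)" if "finite I" for I
  proof -
    have inj\<delta>: "inj_on \<delta> I"
      by (auto simp: inj_on_def \<delta>_def fun_eq_iff split: if_splits)
    show ?thesis
    proof (rule S.independent_if_scalars_zero)
      show "finite (\<delta> ` I)" using that by simp
      fix f x assume 0: "(\<Sum>x\<in>\<delta> ` I. fun_scale (f x) x) = 0" and "x \<in> \<delta> ` I"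
      then obtain i where i: "i \<in> I" "x = \<delta> i" by auto
      have "(\<Sum>i\<in>I. fun_scale (f (\<delta> i)) (\<delta> i)) = 0"
        using 0 by (simp add: sum.reindex[OF inj\<delta>])
      then show "f x = 0"
        using \<delta>_sum[OF that, of "\<lambda>i. f (\<delta> i)" i] i by simp
    qed
  qed
  obtain \<psi> where lin: "Vector_Spaces.linear scaleE fun_scale \<psi>"
    and \<psi>B: "\<And>b. b \<in> B \<Longrightarrow> \<psi> b = \<delta> (g b)"
    using P.linear_independent_extend[OF B(1), of "\<lambda>b. \<delta> (g b)"] by blast
  interpret \<psi>: Vector_Spaces.linear scaleE fun_scale \<psi> by (rule lin)
  have img: "\<psi> ` B = \<delta> ` g ` B"
    using \<psi>B by (auto simp: image_iff)
  have ind: "S.independent (\<psi> ` B)"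
    unfolding img using finB by (intro ind_\<delta>) simp
  have injB: "inj_on \<psi> B"
    using g by (auto simp: inj_on_def \<psi>B \<delta>_def fun_eq_iff split: if_splits)
  have inj: "inj_on \<psi> E"
    using \<psi>.inj_on_span_independent_image[OF ind injB] B(2) by simp
  define \<theta> where "\<theta> = inv_into E \<psi>"
  have \<theta>\<psi>: "\<theta> (\<psi> x) = x" if "x \<in> E" for x
    using inj that by (simp add: \<theta>_def)
  define mul' where "mul' a b = \<psi> (mulE (\<theta> a) (\<theta> b))" for a b
  have mul'_\<psi>: "mul' (\<psi> x) (\<psi> y) = \<psi> (mulE x y)" if "x \<in> E" "y \<in> E" for x y
    using that by (simp add: mul'_def \<theta>\<psi>)
  have closed: "x + y \<in> E" "scaleE c x \<in> E" if "x \<in> E" "y \<in> E" for x y c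
    using that E.subspace_carrier by (auto simp: E.subspace_add E.subspace_scale)
  have alg: "nonassoc_algebra fun_scale (\<psi> ` E) mul'"
  proof unfold_locales
    show "S.subspace (\<psi> ` E)"
      by (rule \<psi>.subspace_image[OF E.subspace_carrier])
  qed (auto simp: mul'_\<psi> closed E.mul_closed E.mul_add_left E.mul_add_right
      E.mul_scale_left E.mul_scale_right simp flip: \<psi>.add \<psi>.scale)
  have BE: "B \<subseteq> E" using B(2) E.span_superset by blast
  have "natural_basis fun_scale (\<psi> ` E) mul' (\<psi> ` B)"
    unfolding natural_basis_def
  proof (intro conjI ballI impI)
    show "S.span (\<psi> ` B) = \<psi> ` E" using \<psi>.span_image[of B] B(2) by simp
    fix x y assume "x \<in> \<psi> ` B" "y \<in> \<psi> ` B" "x \<noteq> y"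
    then obtain a b where ab: "x = \<psi> a" "y = \<psi> b" "a \<in> B" "b \<in> B" "a \<noteq> b" by auto
    then have "a \<in> E" "b \<in> E" using BE by auto
    then show "mul' x y = 0" using ab orth[of a b] by (simp add: mul'_\<psi> \<psi>.zero)
  qed (use ind in simp)
  then have evo: "evolution_algebra fun_scale (\<psi> ` E) mul'"
    using alg by (auto simp: evolution_algebra_def)
  have mono: "algebra_mono scaleA mulA fun_scale (\<psi> ` E) mul' (\<psi> \<circ> \<phi>)"
    unfolding algebra_mono_def
  proof (intro conjI allI)
    show "Vector_Spaces.linear scaleA fun_scale (\<psi> \<circ> \<phi>)"
      using assms(2) lin by (auto simp: algebra_mono_def intro: Vector_Spaces.linear_compose)
    show "inj (\<psi> \<circ> \<phi>)"
      using assms(2) inj by (auto simp: algebra_mono_def intro: comp_inj_on inj_on_subset)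
  qed (use assms(2) in \<open>auto simp: algebra_mono_def mul'_\<psi> image_subset_iff\<close>)
  have "edim scaleA mulA \<le> edimension fun_scale (\<psi> ` E)"
    unfolding edim_def using evo mono by (intro Inf_lower) blast
  also have "\<psi> ` E = S.span (\<psi> ` B)"
    using \<psi>.span_image[of B] B(2) by simp
  also have "edimension fun_scale (S.span (\<psi> ` B)) = enat (card B)"
    using ind finB injB
    by (auto simp: edimension_def S.dim_span_eq_card_independent card_image
        simp del: S.dim_span intro!: exI[of _ "\<psi> ` B"])
  also have "enat (card B) = edimension scaleE E"
    using True B E.dim_span_eq_card_independent[of B] by (simp add: edimension_def del: E.dim_span)
  finally show ?thesis .
qed

end

theory Submission
  imports Defs
begin

text \<open>
  Polarisation (available since \<open>2 \<noteq> 0\<close>) turns a Waring decomposition \<open>x\<^sup>2 = \<Sum>\<^sub>k \<ell>\<^sub>k(x)\<^sup>2 v\<^sub>k\<close> into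
  \<open>xy = \<Sum>\<^sub>k \<ell>\<^sub>k(x) \<ell>\<^sub>k(y) v\<^sub>k\<close>. Hence an injective \<open>L\<close> is an algebra monomorphism into \<open>F\<^sup>m\<close>
  equipped with the evolution product \<open>e\<^sub>k\<^sup>2 = L(v\<^sub>k)\<close>. Conversely, for a monomorphism \<open>\<phi>\<close> into an
  evolution algebra with natural basis \<open>b\<^sub>k\<close> and a linear left inverse \<open>\<psi>\<close> of \<open>\<phi>\<close>, the
  coordinates of \<open>\<phi>(x)\<close> together with \<open>v\<^sub>k = \<psi>(b\<^sub>k\<^sup>2)\<close> form an injective Waring decomposition.
  If \<open>m = dim A\<close> then \<open>L\<close> is an isomorphism, and the \<open>L\<close>-preimages of the unit vectors
  form a natural basis of \<open>A\<close>.
\<close>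

section \<open>Coordinate spaces inside the sequence space\<close>

interpretation seq: vector_space "fun_scale :: 'f::field \<Rightarrow> (nat \<Rightarrow> 'f) \<Rightarrow> nat \<Rightarrow> 'f"
  by (rule vector_space_fun_scale)

definition unit_seq :: "nat \<Rightarrow> nat \<Rightarrow> 'f::field" where
  "unit_seq i = (\<lambda>j. if j = i then 1 else 0)"

text \<open>This is the copy of \<open>F^m\<close> inside the sequence space in which
  \<open>waring_map\<close> takes its values.\<close>

definition padded :: "nat \<Rightarrow> (nat \<Rightarrow> 'f::field) set" where
  "padded m = {f. \<forall>i\<ge>m. f i = 0}"

lemma inj_unit_seq: "inj_on (unit_seq :: nat \<Rightarrow> nat \<Rightarrow> 'f::field) I"
  by (auto simp: inj_on_def unit_seq_def fun_eq_iff split: if_splits)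

lemma sum_fun_apply: "(\<Sum>i\<in>I. f i) x = (\<Sum>i\<in>I. f i x)"
  by (induction I rule: infinite_finite_induct) auto

lemma sum_unit_seq:
  "finite I \<Longrightarrow> (\<Sum>i\<in>I. fun_scale (u i) (unit_seq i)) j = (if j \<in> I then u j else 0)"
  by (induction I rule: finite_induct) (auto simp: fun_scale_def unit_seq_def)

lemma independent_unit_seq:
  assumes "finite I"
  shows "seq.independent ((unit_seq :: nat \<Rightarrow> nat \<Rightarrow> 'f::field) ` I)"
proof (rule seq.independent_if_scalars_zero)
  show "finite ((unit_seq :: nat \<Rightarrow> nat \<Rightarrow> 'f) ` I)" using assms by simp
  fix f :: "(nat \<Rightarrow> 'f) \<Rightarrow> 'f" and x :: "nat \<Rightarrow> 'f"
  assume 0: "(\<Sum>x\<in>unit_seq ` I. fun_scale (f x) x) = 0" and "x \<in> unit_seq ` I"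
  then obtain i where i: "i \<in> I" "x = unit_seq i" by auto
  have "(\<Sum>i\<in>I. fun_scale (f (unit_seq i)) (unit_seq i)) = 0"
    using 0 by (simp add: sum.reindex[OF inj_unit_seq])
  then show "f x = 0"
    using sum_unit_seq[OF assms, of "\<lambda>i. f (unit_seq i)" i] i by simp
qed

lemma subspace_padded: "seq.subspace (padded m)"
  by (auto simp: seq.subspace_def padded_def fun_scale_def)

lemma span_unit_seq: "seq.span (unit_seq ` {..<m}) = (padded m :: (nat \<Rightarrow> 'f::field) set)"
proof
  have "unit_seq ` {..<m} \<subseteq> (padded m :: (nat \<Rightarrow> 'f) set)"
    by (auto simp: padded_def unit_seq_def)
  then show "seq.span (unit_seq ` {..<m}) \<subseteq> (padded m :: (nat \<Rightarrow> 'f) set)"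
    by (rule seq.span_minimal[OF _ subspace_padded])
  show "(padded m :: (nat \<Rightarrow> 'f) set) \<subseteq> seq.span (unit_seq ` {..<m})"
  proof
    fix f :: "nat \<Rightarrow> 'f"
    assume "f \<in> padded m"
    then have "f = (\<Sum>i<m. fun_scale (f i) (unit_seq i))"
      by (auto simp: fun_eq_iff sum_unit_seq padded_def)
    also have "\<dots> \<in> seq.span (unit_seq ` {..<m})"
      by (intro seq.span_sum seq.span_scale seq.span_base) auto
    finally show "f \<in> seq.span (unit_seq ` {..<m})" .
  qed
qed

lemma (in vector_space) edimension_span:
  assumes "independent B" "finite B"
  shows "edimension scale (span B) = enat (card B)"
  using assms by (auto simp: edimension_def dim_span_eq_card_independent simp del: dim_span)

lemma edimension_padded: "edimension fun_scale (padded m :: (nat \<Rightarrow> 'f::field) set) = enat m"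
  using seq.edimension_span[OF independent_unit_seq, of "{..<m}", where 'f='f]
  by (simp add: span_unit_seq card_image[OF inj_unit_seq])

section \<open>From monomorphisms into evolution algebras to Waring decompositions\<close>

lemma natural_basis_square:
  assumes "nonassoc_algebra scale E mul" "natural_basis scale E mul B" "finite B"
  shows "mul (\<Sum>b\<in>B. scale (c b) b) (\<Sum>b\<in>B. scale (c b) b) = (\<Sum>b\<in>B. scale ((c b)\<^sup>2) (mul b b))"
proof -
  interpret nonassoc_algebra scale E mul by (rule assms(1))
  have BE: "B \<subseteq> E" and orth: "\<And>x y. \<lbrakk>x \<in> B; y \<in> B; x \<noteq> y\<rbrakk> \<Longrightarrow> mul x y = 0"
    using assms(2) span_superset by (auto simp: natural_basis_def)
  \<comment> \<open>Bilinearity is only available for arguments in \<open>E\<close>, so the partial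
    sums met in the inductions below must be known to lie there.\<close>
  have sum_in: "(\<Sum>b\<in>S. scale (c b) b) \<in> E" if "S \<subseteq> B" for S
    using that BE by (intro subspace_sum[OF subspace_carrier] subspace_scale[OF subspace_carrier]) auto
  have scale_in: "scale c x \<in> E" if "x \<in> E" for c x
    using subspace_scale[OF subspace_carrier that] .
  have mul_zero: "mul 0 y = 0" "mul y 0 = 0" if "y \<in> E" for y
    using mul_scale_left[OF that that, of 0] mul_scale_right[OF that that, of 0] by simp_all
  have left: "mul (\<Sum>b\<in>S. scale (c b) b) y = (\<Sum>b\<in>S. scale (c b) (mul b y))"
    if "finite S" "S \<subseteq> B" "y \<in> E" for S y
    using that
  proof (induction S rule: finite_induct)
    case (insert b S)
    then show ?case
      using BE sum_in[of S] by (auto simp: mul_add_left scale_in mul_scale_left subset_iff)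
  qed (simp add: mul_zero)
  have right: "mul y (\<Sum>b\<in>S. scale (c b) b) = (\<Sum>b\<in>S. scale (c b) (mul y b))"
    if "finite S" "S \<subseteq> B" "y \<in> E" for S y
    using that
  proof (induction S rule: finite_induct)
    case (insert b S)
    then show ?case
      using BE sum_in[of S] by (auto simp: mul_add_right scale_in mul_scale_right subset_iff)
  qed (simp add: mul_zero)
  \<comment> \<open>Orthogonality of the natural basis leaves only the diagonal term. Expanding the
    left factor as well then gives the square of each coefficient.\<close>
  have "mul b (\<Sum>b\<in>B. scale (c b) b) = scale (c b) (mul b b)" if "b \<in> B" for b
  proof -
    have "mul b (\<Sum>b\<in>B. scale (c b) b) = (\<Sum>a\<in>B. scale (c a) (mul b a))"
      using that BE assms(3) by (intro right) auto
    also have "\<dots> = (\<Sum>a\<in>{b}. scale (c a) (mul b a))"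
      using that assms(3) by (intro sum.mono_neutral_right) (auto simp: orth)
    finally show ?thesis by simp
  qed
  then show ?thesis
    using left[OF assms(3) subset_refl sum_in[OF subset_refl]] by (simp add: power2_eq_square)
qed

text \<open>The carrier type of the target is arbitrary, so that the bound covers both the sequence
  algebras in \<open>edim\<close> and the identity map of an algebra that is itself an evolution
  algebra.\<close>

lemma sr_le_edimension:
  fixes scaleA :: "'f::field \<Rightarrow> 'a::ab_group_add \<Rightarrow> 'a"
    and scaleE :: "'f \<Rightarrow> 'e::ab_group_add \<Rightarrow> 'e"
  assumes "evolution_algebra scaleE E mulE" and "algebra_mono scaleA mulA scaleE E mulE \<phi>"
  shows "sr scaleA (\<lambda>x. mulA x x) \<le> edimension scaleE E"
proof (cases "\<exists>B. finite B \<and> E \<subseteq> module.span scaleE B")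
  case False
  then show ?thesis unfolding edimension_def by (simp only: if_False) simp
next
  case True
  from assms(1) have alg: "nonassoc_algebra scaleE E mulE"
    by (simp add: evolution_algebra_def)
  interpret E: nonassoc_algebra scaleE E mulE by (rule alg)
  have lin\<phi>: "Vector_Spaces.linear scaleA scaleE \<phi>" and range: "\<And>x. \<phi> x \<in> E"
    and mult: "\<And>x y. \<phi> (mulA x y) = mulE (\<phi> x) (\<phi> y)" and "inj \<phi>"
    using assms(2) by (auto simp: algebra_mono_def)
  interpret \<phi>: Vector_Spaces.linear scaleA scaleE \<phi> by (rule lin\<phi>)
  interpret P: vector_space_pair scaleA scaleE ..
  obtain B where nat: "natural_basis scaleE E mulE B"
    using assms(1) by (auto simp: evolution_algebra_def)
  then have B: "E.independent B" "E.span B = E"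
    by (auto simp: natural_basis_def)
  have finB: "finite B"
    using True E.independent_span_bound[OF _ B(1)] B(2) E.span_superset[of B] by blast
  \<comment> \<open>The map \<psi> is only linear. That suffices: the multiplication is done in
    \<open>E\<close>, and \<psi> merely carries the expanded square back.\<close>
  obtain \<psi> where lin\<psi>: "Vector_Spaces.linear scaleE scaleA \<psi>" and "\<psi> \<circ> \<phi> = id"
    using P.linear_injective_left_inverse[OF lin\<phi> \<open>inj \<phi>\<close>] by blast
  then have \<psi>\<phi>: "\<psi> (\<phi> x) = x" for x by (simp add: fun_eq_iff)
  interpret \<psi>: Vector_Spaces.linear scaleE scaleA \<psi> by (rule lin\<psi>)
  obtain b where b: "bij_betw b {..<card B} B"
    using ex_bij_betw_nat_finite[OF finB] by (auto simp: atLeast0LessThan)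
  define l where "l k x = E.representation B (\<phi> x) (b k)" for k x
  define v where "v k = \<psi> (mulE (b k) (b k))" for k
  have expand: "(\<Sum>a\<in>B. scaleE (E.representation B (\<phi> x) a) a) = \<phi> x" for x
    using B range finB by (intro E.sum_representation_eq) auto
  have "waring_decomposition scaleA (\<lambda>x. mulA x x) (card B) l v"
    unfolding waring_decomposition_def
  proof (intro conjI allI impI)
    fix k
    show "Vector_Spaces.linear scaleA (*) (l k)"
      using B range
      by unfold_locales
        (auto simp: l_def \<phi>.add \<phi>.scale E.representation_add E.representation_scale algebra_simps)
  next
    fix x
    have "mulA x x = \<psi> (mulE (\<phi> x) (\<phi> x))"
      by (simp add: \<psi>\<phi> flip: mult)
    also have "mulE (\<phi> x) (\<phi> x) = (\<Sum>a\<in>B. scaleE ((E.representation B (\<phi> x) a)\<^sup>2) (mulE a a))"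
      using natural_basis_square[OF alg nat finB, of "E.representation B (\<phi> x)"] by (simp add: expand)
    also have "\<psi> \<dots> = (\<Sum>a\<in>B. scaleA ((E.representation B (\<phi> x) a)\<^sup>2) (\<psi> (mulE a a)))"
      by (simp add: \<psi>.sum \<psi>.scale)
    also have "\<dots> = (\<Sum>k<card B. scaleA ((l k x)\<^sup>2) (v k))"
      unfolding l_def v_def by (rule sum.reindex_bij_betw[OF b, symmetric])
    finally show "mulA x x = (\<Sum>k<card B. scaleA ((l k x)\<^sup>2) (v k))" .
  qed
  moreover have "inj (waring_map (card B) l)"
  proof (rule injI)
    fix x y assume eq: "waring_map (card B) l x = waring_map (card B) l y"
    \<comment> \<open>Equal values of the Waring map mean equal coordinates of \<phi> x and \<phi>
      y, and these determine both vectors.\<close>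
    have "E.representation B (\<phi> x) a = E.representation B (\<phi> y) a" if "a \<in> B" for a
    proof -
      from b that obtain k where "k < card B" "a = b k"
        by (auto simp: bij_betw_def)
      then show ?thesis
        using fun_cong[OF eq, of k] by (simp add: waring_map_def l_def)
    qed
    then have "(\<Sum>a\<in>B. scaleE (E.representation B (\<phi> x) a) a) =
        (\<Sum>a\<in>B. scaleE (E.representation B (\<phi> y) a) a)"
      by (intro sum.cong refl arg_cong2[where f=scaleE])
    then have "\<phi> x = \<phi> y"
      by (simp only: expand)
    then show "x = y" using \<open>inj \<phi>\<close> by (simp add: inj_eq)
  qed
  ultimately have "sr scaleA (\<lambda>x. mulA x x) \<le> enat (card B)"
    unfolding sr_def by (intro Inf_lower) blast
  then show ?thesis
    using E.edimension_span[OF B(1) finB] B(2) by simp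
qed

section \<open>From injective Waring decompositions to evolution algebras\<close>

lemma linear_waring_map:
  assumes "vector_space scale" "waring_decomposition scale H m l v"
  shows "Vector_Spaces.linear scale fun_scale (waring_map m l)"
proof -
  have "Vector_Spaces.linear scale (*) (l k)" if "k < m" for k
    using assms(2) that by (simp add: waring_decomposition_def)
  note lin = this[THEN Vector_Spaces.linear.axioms(3), unfolded module_hom_def module_hom_axioms_def]
  show ?thesis
    by (intro Vector_Spaces.linear.intro assms(1) vector_space_fun_scale module_hom.intro
        module_hom_axioms.intro assms(1)[unfolded module_iff_vector_space[symmetric]]
        vector_space_fun_scale[unfolded module_iff_vector_space[symmetric]])
      (auto simp: waring_map_def fun_eq_iff fun_scale_def lin)
qed

context nonassoc_algebra
begin

text \<open>By commutativity, (x+y)^2 - x^2 - y^2 = 2xy. The same identity applied to each linear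
  form yields 2 l_k(x) l_k(y), and 2 can be cancelled.\<close>

lemma waring_polarization:
  assumes "CHAR('f) \<noteq> 2" "E = UNIV" "\<And>x y. mul x y = mul y x"
    and waring: "waring_decomposition scale (\<lambda>x. mul x x) m l v"
  shows "mul x y = (\<Sum>k<m. scale (l k x * l k y) (v k))"
proof -
  have two: "(2 :: 'f) \<noteq> 0"
  proof
    assume "(2 :: 'f) = 0"
    then have "CHAR('f) dvd 2"
      using of_nat_eq_0_iff_char_dvd[of 2, where 'a='f] by simp
    \<comment> \<open>Characteristic 1 is impossible in a field, as 1 and 0 differ.\<close>
    then have "CHAR('f) = 1 \<or> CHAR('f) = 2"
      using two_is_prime_nat unfolding prime_nat_iff by blast
    then show False using assms(1) CHAR_not_1[where 'a='f] by simp
  qed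
  have lin: "l k (x + y) = l k x + l k y" if "k < m" for k
  proof -
    have "Vector_Spaces.linear scale (*) (l k)"
      using waring that by (simp add: waring_decomposition_def)
    then show ?thesis
      by (rule module_hom.add[OF Vector_Spaces.linear.axioms(3)])
  qed
  have sq: "mul x x = (\<Sum>k<m. scale ((l k x)\<^sup>2) (v k))" for x
    using waring by (simp add: waring_decomposition_def)
  have "scale 2 (mul x y) = mul x y + mul x y"
    using scale_left_distrib[of 1 1 "mul x y"] by simp
  also have "\<dots> = mul (x + y) (x + y) - mul x x - mul y y"
    using assms(2) by (simp add: mul_add_left mul_add_right assms(3)[of y x])
  also have "\<dots> = (\<Sum>k<m. scale (2 * (l k x * l k y)) (v k))"
    unfolding sq sum_subtractf[symmetric] scale_left_diff_distrib[symmetric]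
    by (intro sum.cong refl) (simp add: lin power2_sum mult.assoc)
  also have "\<dots> = scale 2 (\<Sum>k<m. scale (l k x * l k y) (v k))"
    by (simp add: scale_sum_right)
  finally show ?thesis
    using two by simp
qed

lemma edim_le_waring:
  assumes "CHAR('f) \<noteq> 2" "E = UNIV" "\<And>x y. mul x y = mul y x"
    and waring: "waring_decomposition scale (\<lambda>x. mul x x) m l v" and inj: "inj (waring_map m l)"
  shows "edim scale mul \<le> enat m"
proof -
  let ?L = "waring_map m l"
  have lin: "Vector_Spaces.linear scale fun_scale ?L"
    by (rule linear_waring_map[OF vector_space_axioms waring])
  interpret L: Vector_Spaces.linear scale fun_scale ?L by (rule lin)
  \<comment> \<open>Writing the product through coordinates makes bilinearity immediate. Distinct
    unit sequences have disjoint supports, so they multiply to 0, and the formula matches the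
    polarised decomposition term by term.\<close>
  define mulE where "mulE f g = (\<Sum>k<m. fun_scale (f k * g k) (?L (v k)))" for f g :: "nat \<Rightarrow> 'f"
  have L_in: "?L x \<in> padded m" for x
    by (auto simp: waring_map_def padded_def)
  have "nonassoc_algebra fun_scale (padded m) mulE"
  proof
    show "mulE x y \<in> padded m" for x y
      unfolding mulE_def
      by (intro seq.subspace_sum seq.subspace_scale subspace_padded L_in)
  qed (auto simp: subspace_padded mulE_def fun_eq_iff fun_scale_def sum_distrib_left sum_fun_apply
      algebra_simps simp flip: sum.distrib)
  moreover have "natural_basis fun_scale (padded m) mulE (unit_seq ` {..<m})"
    unfolding natural_basis_def
    by (intro conjI independent_unit_seq span_unit_seq)
      (auto simp: mulE_def unit_seq_def intro!: sum.neutral)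
  ultimately have "evolution_algebra fun_scale (padded m) mulE"
    by (auto simp: evolution_algebra_def)
  moreover have "algebra_mono scale mul fun_scale (padded m) mulE ?L"
    unfolding algebra_mono_def
  proof (intro conjI allI)
    fix x y
    have "?L (mul x y) = (\<Sum>k<m. fun_scale (l k x * l k y) (?L (v k)))"
      by (simp add: waring_polarization[OF assms(1-4)] L.sum L.scale)
    then show "?L (mul x y) = mulE (?L x) (?L y)"
      by (simp add: mulE_def waring_map_def)
  qed (use lin L_in inj in auto)
  ultimately show ?thesis
    using edim_le edimension_padded by metis
qed

lemma evolution_algebra_if_waring_dim:
  assumes "CHAR('f) \<noteq> 2" "E = UNIV" "\<And>x y. mul x y = mul y x"
    and fin: "finite C" "span C = UNIV"
    and waring: "waring_decomposition scale (\<lambda>x. mul x x) m l v" and inj: "inj (waring_map m l)"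
    and dim: "dim UNIV = m"
  shows "evolution_algebra scale E mul"
proof -
  let ?L = "waring_map m l"
  interpret L: Vector_Spaces.linear scale fun_scale ?L
    by (rule linear_waring_map[OF vector_space_axioms waring])
  have L_in: "?L x \<in> padded m" for x
    by (auto simp: waring_map_def padded_def)
  interpret P: vector_space_pair scale "fun_scale :: 'f \<Rightarrow> (nat \<Rightarrow> 'f) \<Rightarrow> _" ..
  obtain D where "independent D" "UNIV \<subseteq> span D"
    by (rule maximal_independent_subset[of UNIV])
  then have D: "independent D" "span D = UNIV" by auto
  have finD: "finite D"
    using independent_span_bound[OF fin(1) D(1)] fin(2) by simp
  have cardD: "card D = m"
    using dim dim_span_eq_card_independent[OF D(1)] D(2) by simp
  have ind: "seq.independent (?L ` D)"
    by (intro L.independent_injective_image D(1) inj_on_subset[OF inj]) simp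
  \<comment> \<open>Here the hypothesis on the dimension enters: the image of \<open>D\<close>
    consists of m independent vectors, and a vector outside their span would give m+1 independent
    vectors in the span of m unit sequences.\<close>
  have surj: "padded m \<subseteq> range ?L"
  proof
    fix f :: "nat \<Rightarrow> 'f" assume f: "f \<in> padded m"
    have "f \<in> seq.span (?L ` D)"
    proof (rule ccontr)
      assume notin: "f \<notin> seq.span (?L ` D)"
      then have "seq.independent (insert f (?L ` D))"
        by (rule seq.independent_insertI[OF _ ind])
      moreover have "insert f (?L ` D) \<subseteq> seq.span (unit_seq ` {..<m})"
        using f L_in by (auto simp: span_unit_seq)
      moreover have "finite (unit_seq ` {..<m} :: (nat \<Rightarrow> 'f) set)" by simp
      ultimately have "card (insert f (?L ` D)) \<le> card (unit_seq ` {..<m} :: (nat \<Rightarrow> 'f) set)"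
        using seq.independent_span_bound by blast
      moreover have "f \<notin> ?L ` D"
        using notin seq.span_base by blast
      moreover have "card (?L ` D) = m"
        using cardD inj_on_subset[OF inj] by (simp add: card_image)
      ultimately show False
        using finD by (simp add: card_image[OF inj_unit_seq])
    qed
    then show "f \<in> range ?L"
      using L.span_image[of D] D(2) by simp
  qed
  obtain \<psi> where lin\<psi>: "Vector_Spaces.linear fun_scale scale \<psi>" and "\<psi> \<circ> ?L = id"
    using P.linear_injective_left_inverse[OF L.linear_axioms inj] by blast
  then have \<psi>L: "\<psi> (?L x) = x" for x by (simp add: fun_eq_iff)
  \<comment> \<open>A left inverse is also a right inverse on the range, which contains
    \<open>padded m\<close> by \<open>surj\<close>.\<close>
  then have L\<psi>: "?L (\<psi> f) = f" if "f \<in> padded m" for f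
    using surj that by auto
  interpret \<psi>: Vector_Spaces.linear fun_scale scale \<psi> by (rule lin\<psi>)
  define e where "e i = \<psi> (unit_seq i)" for i
  have Le: "?L (e i) = unit_seq i" if "i < m" for i
    using that unfolding e_def by (intro L\<psi>) (auto simp: padded_def unit_seq_def)
  \<comment> \<open>The forms are dual to the vectors \<open>e i\<close>. For distinct i and j every
    product l_k(e_i) l_k(e_j) therefore vanishes, which kills the polarised formula for the
    product.\<close>
  then have le: "l k (e i) = (if k = i then 1 else 0)" if "i < m" "k < m" for i k
    using fun_cong[OF Le[OF that(1)], of k] that(2)
    unfolding waring_map_def unit_seq_def by (simp split del: if_split)
  have img: "?L ` e ` {..<m} = unit_seq ` {..<m}"
    unfolding image_image by (intro image_cong) (auto simp: Le)
  have "natural_basis scale E mul (e ` {..<m})"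
    unfolding natural_basis_def
  proof (intro conjI ballI impI)
    show "independent (e ` {..<m})"
    proof -
      have "inj_on \<psi> (seq.span (unit_seq ` {..<m}))"
        unfolding span_unit_seq by (rule inj_on_inverseI[OF L\<psi>])
      then have "independent (\<psi> ` unit_seq ` {..<m})"
        by (intro \<psi>.independent_injective_image independent_unit_seq) simp
      then show ?thesis by (simp add: image_image e_def)
    qed
    show "span (e ` {..<m}) = E"
    proof -
      have "?L ` span (e ` {..<m}) = padded m"
        by (simp add: img span_unit_seq flip: L.span_image)
      \<comment> \<open>Since \<open>?L\<close> is injective, membership of \<open>?L x\<close> in
        the image of the span pulls back to x.\<close>
      then have "x \<in> span (e ` {..<m})" for x
        using L_in[of x] inj_image_mem_iff[OF inj] by blast
      then show ?thesis using assms(2) by auto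
    qed
    fix x y assume "x \<in> e ` {..<m}" "y \<in> e ` {..<m}" "x \<noteq> y"
    then obtain i j where "x = e i" "y = e j" "i < m" "j < m" "i \<noteq> j"
      by auto
    then show "mul x y = 0"
      by (auto simp: waring_polarization[OF assms(1-3) waring] le intro!: sum.neutral)
  qed
  then show ?thesis
    using nonassoc_algebra_axioms by (auto simp: evolution_algebra_def)
qed

end

section \<open>Attainment of the rank and comparison of the invariants\<close>

lemma Inf_enat_attained:
  assumes "Inf {enat m | m. P m} = enat n"
  shows "P n"
proof -
  \<comment> \<open>The infimum of the empty set is infinite, contrary to the finite value n. A
    nonempty set of extended naturals contains its infimum by well-ordering.\<close>
  have "{enat m | m. P m} \<noteq> {}"
  proof
    assume "{enat m | m. P m} = {}"
    with assms show False by (simp only: Inf_enat_def) simp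
  qed
  then have "Inf {enat m | m. P m} \<in> {enat m | m. P m}"
    by (metis (no_types, lifting) wellorder_InfI ex_in_conv)
  then show ?thesis using assms by auto
qed

theorem corollary4p3:
  fixes scale :: "'f::field \<Rightarrow> 'a::ab_group_add \<Rightarrow> 'a"
    and Basis :: "'a set"
    and mul :: "'a \<Rightarrow> 'a \<Rightarrow> 'a"
  assumes "CHAR('f) \<noteq> 2"
    and "finite_dimensional_vector_space scale Basis"
    and "nonassoc_algebra scale UNIV mul"
    and "\<And>x y. mul x y = mul y x"
  shows "edim scale mul = sr scale (\<lambda>x. mul x x) \<and>
    (evolution_algebra scale UNIV mul \<longleftrightarrow>
       sr scale (\<lambda>x. mul x x) = enat (vector_space.dim scale UNIV))"
proof -
  interpret finite_dimensional_vector_space scale Basis by (rule assms(2))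
  interpret A: nonassoc_algebra scale UNIV mul by (rule assms(3))
  let ?sr = "sr scale (\<lambda>x. mul x x)"
  have "?sr \<le> edim scale mul"
    unfolding edim_def by (rule Inf_greatest) (auto intro: sr_le_edimension)
  moreover have "edim scale mul \<le> ?sr"
    unfolding sr_def
    by (rule Inf_greatest) (auto intro: A.edim_le_waring[OF assms(1) refl assms(4)])
  ultimately have eq: "edim scale mul = ?sr" by simp
  \<comment> \<open>An injective Waring map sends a basis to independent vectors in
    \<open>F^m\<close>, so no admissible length is below the dimension.\<close>
  have dim_le: "enat (dim UNIV) \<le> ?sr"
    unfolding sr_def
  proof (rule Inf_greatest, safe)
    fix m l v assume waring: "waring_decomposition scale (\<lambda>x. mul x x) m l v"
      and inj: "inj (waring_map m l)"
    interpret L: Vector_Spaces.linear scale fun_scale "waring_map m l"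
      by (rule linear_waring_map[OF vector_space_axioms waring])
    have "seq.independent (waring_map m l ` Basis)"
      by (intro L.independent_injective_image independent_Basis inj_on_subset[OF inj]) simp
    moreover have "waring_map m l ` Basis \<subseteq> seq.span (unit_seq ` {..<m})"
      by (auto simp: span_unit_seq waring_map_def padded_def)
    ultimately have "card (waring_map m l ` Basis) \<le> card (unit_seq ` {..<m} :: (nat \<Rightarrow> 'f) set)"
      using seq.independent_span_bound by blast
    then show "enat (dim UNIV) \<le> enat m"
      using inj by (simp add: card_image[OF inj_unit_seq] card_image inj_on_subset dim_UNIV)
  qed
  have "?sr = enat (dim UNIV)" if "evolution_algebra scale UNIV mul"
  proof (rule antisym[OF _ dim_le])
    \<comment> \<open>The algebra serves as its own evolution target, which bounds the rank by its
      dimension.\<close>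
    have "algebra_mono scale mul scale UNIV mul id"
      using linear_id by (simp add: algebra_mono_def)
    then have "?sr \<le> edimension scale UNIV"
      by (rule sr_le_edimension[OF that])
    then show "?sr \<le> enat (dim UNIV)"
      using edimension_span[OF independent_Basis finite_Basis] by (simp add: span_Basis dim_UNIV)
  qed
  moreover have "evolution_algebra scale UNIV mul" if sr: "?sr = enat (dim UNIV)"
  proof -
    obtain l v where "waring_decomposition scale (\<lambda>x. mul x x) (dim UNIV) l v"
      "inj (waring_map (dim UNIV) l)"
      using Inf_enat_attained[OF sr[unfolded sr_def]] by blast
    then show ?thesis
      using A.evolution_algebra_if_waring_dim[OF assms(1) refl assms(4) finite_Basis span_Basis]
      by blast
  qed
  ultimately show ?thesis using eq by blast
qed

end
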